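(* Let $c$ be a fixed positive integer and let $\mathcal{F}_c$ be the family of graphs having maximum degree at most $c$. Let $G$ be a graph of order $n$ with a universal vertex $u$ such that $G-u\in\mathcal{F}_c$. Then $\operatorname{ept}(G)=\Theta(\log n)$; that is, there exist constants $c_1,c_2>0$ and $n_0$, depending only on $c$, such that $c_1\log n\le\operatorname{ept}(G)\le c_2\log n$ for every such graph $G$ of order $n\ge n_0$.
   Context: Graphs are finite, simple and undirected. $N[u]=N(u)\cup\{u\}$ is the closed neighborhood of $u$. Probabilistic zero forcing: each vertex of a connected graph $G$ is blue or white. In one round, with $C$ the set of vertices that are blue at the start of the round, every blue vertex $u$ attempts to force each of its white neighbors $w$, all attempts being independent, each succeeding with probability $\Pr(u\to w)=\frac{|N[u]\cap C|}{\deg u}$. A white vertex becomes blue in the round if at least one blue neighbor succeeds in forcing it; blue vertices stay blue. For a nonempty set $B$ of vertices, $\operatorname{pt}_{pzf}(G,B)$ is the random number of the round in which the last white vertex turns blue when initially exactly the vertices in $B$ are blue (it is $0$ if $B=V(G)$), and $\operatorname{ept}(G,B)=\mathbf{E}[\operatorname{pt}_{pzf}(G,B)]$. The expected propagation time of $G$ is $\operatorname{ept}(G)=\min\{\operatorname{ept}(G,\{v\}):v\in V(G)\}$. A universal vertex is one adjacent to every other vertex; $G-u$ is the graph obtained from $G$ by removing $u$ and all edges containing $u$ (it need not be connected). The order of a graph is its number of vertices. *)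

theory Defs
  imports "HOL-Probability.Probability" "HOL-Probability.Product_PMF" "Graph_Theory.Digraph"
begin

section \<open>Graphs\<close>

text \<open>
  A finite simple undirected graph is a \<^term>\<open>G\<close> with \<^term>\<open>graph G\<close>: the library models it as a
  finite loop-free symmetric digraph without parallel arcs, so every undirected edge is a pair of
  opposite arcs, and the degree of a vertex is its out-degree.
\<close>

definition closed_nbhd :: "('a, 'b) pre_digraph \<Rightarrow> 'a \<Rightarrow> 'a set" where
  "closed_nbhd G u = insert u {v. u \<rightarrow>\<^bsub>G\<^esub> v}"

definition universal_vertex :: "('a, 'b) pre_digraph \<Rightarrow> 'a \<Rightarrow> bool" where
  "universal_vertex G u \<longleftrightarrow> u \<in> verts G \<and> (\<forall>v\<in>verts G. v \<noteq> u \<longrightarrow> u \<rightarrow>\<^bsub>G\<^esub> v)"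

text \<open>The inserted \<open>0\<close> only matters for the graph without vertices, whose maximum degree is \<open>0\<close>.\<close>

definition max_degree :: "('a, 'b) pre_digraph \<Rightarrow> nat" where
  "max_degree G = Max (insert 0 (out_degree G ` verts G))"

definition bounded_degree_graphs :: "nat \<Rightarrow> ('a, 'b) pre_digraph set" where
  "bounded_degree_graphs c = {H. graph H \<and> max_degree H \<le> c}"


section \<open>Probabilistic zero forcing\<close>

definition force_prob :: "('a, 'b) pre_digraph \<Rightarrow> 'a set \<Rightarrow> 'a \<Rightarrow> real" where
  "force_prob G C u = real (card (closed_nbhd G u \<inter> C)) / real (out_degree G u)"

definition attempts :: "('a, 'b) pre_digraph \<Rightarrow> 'a set \<Rightarrow> ('a \<times> 'a) set" where
  "attempts G C = {(u, w). u \<in> C \<and> w \<notin> C \<and> u \<rightarrow>\<^bsub>G\<^esub> w}"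

text \<open>
  Distribution of the blue set after one round that starts with blue set \<open>C\<close>. In \<open>attempts G C\<close>
  the forcing vertex has a white neighbour, so \<^term>\<open>force_prob G C u\<close> lies in \<open>[0, 1]\<close> and
  \<^const>\<open>bernoulli_pmf\<close> does not truncate it.
\<close>

definition pzf_round :: "('a, 'b) pre_digraph \<Rightarrow> 'a set \<Rightarrow> 'a set pmf" where
  "pzf_round G C =
     map_pmf (\<lambda>s. C \<union> {w. \<exists>u. (u, w) \<in> attempts G C \<and> s (u, w)})
       (Pi_pmf (attempts G C) False (\<lambda>(u, w). bernoulli_pmf (force_prob G C u)))"

text \<open>
  The process itself, as the law of the sequence \<open>\<omega>\<close> of blue sets, where \<open>\<omega> t\<close> is the blue set
  after \<open>t\<close> rounds. It is the Ionescu-Tulcea measure of the kernels below.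
\<close>

definition pzf_kernel ::
  "('a, 'b) pre_digraph \<Rightarrow> 'a set \<Rightarrow> nat \<Rightarrow> (nat \<Rightarrow> 'a set) \<Rightarrow> 'a set measure" where
  "pzf_kernel G B t \<omega> =
     measure_pmf (case t of 0 \<Rightarrow> return_pmf B | Suc s \<Rightarrow> pzf_round G (\<omega> s))"

definition pzf_process :: "('a, 'b) pre_digraph \<Rightarrow> 'a set \<Rightarrow> (nat \<Rightarrow> 'a set) measure" where
  "pzf_process G B =
     projective_family.lim UNIV
       (Ionescu_Tulcea.CI (pzf_kernel G B) (\<lambda>_. count_space UNIV)) (\<lambda>_. count_space UNIV)"

lemma Ionescu_Tulcea_pzf_kernel:
  fixes G :: "('a, 'b) pre_digraph" and B :: "'a set"
  shows "Ionescu_Tulcea (pzf_kernel G B) (\<lambda>_. count_space UNIV)"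
proof (rule Ionescu_Tulcea.intro)
  fix t :: nat
  show "pzf_kernel G B t \<in> measurable (\<Pi>\<^sub>M i\<in>{0..<t}. count_space UNIV)
          (subprob_algebra (count_space UNIV))"
  proof (cases t)
    case 0
    have "pzf_kernel G B 0 = (\<lambda>_. measure_pmf (return_pmf B))"
      by (simp add: pzf_kernel_def fun_eq_iff)
    then show ?thesis
      using 0 by (simp add: space_subprob_algebra measure_pmf.subprob_space_axioms)
  next
    case (Suc s)
    have [measurable]: "(\<lambda>\<omega>. \<omega> s) \<in> measurable (\<Pi>\<^sub>M i\<in>{0..<t}. count_space UNIV)
            (count_space (UNIV :: 'a set set))"
      using Suc by (intro measurable_component_singleton) simp
    have "(\<lambda>\<omega>. measure_pmf (pzf_round G (\<omega> s))) \<in> measurable (\<Pi>\<^sub>M i\<in>{0..<t}. count_space UNIV)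
            (subprob_algebra (count_space UNIV))"
      by (rule measurable_compose[where f="\<lambda>\<omega>. \<omega> s" and N="count_space UNIV"])
         (auto simp: space_subprob_algebra measure_pmf.subprob_space_axioms)
    moreover have "pzf_kernel G B (Suc s) = (\<lambda>\<omega>. measure_pmf (pzf_round G (\<omega> s)))"
      by (simp add: pzf_kernel_def fun_eq_iff)
    ultimately show ?thesis
      using Suc by simp
  qed
next
  fix t :: nat and \<omega> :: "nat \<Rightarrow> 'a set"
  assume "\<omega> \<in> space (\<Pi>\<^sub>M i\<in>{0..<t}. count_space UNIV)"
  show "prob_space (pzf_kernel G B t \<omega>)"
    by (simp add: pzf_kernel_def measure_pmf.prob_space_axioms)
qed

text \<open>The infimum over no rounds is \<open>\<infinity>\<close>: the propagation time if some vertex stays white forever.\<close>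

definition pt_pzf :: "('a, 'b) pre_digraph \<Rightarrow> (nat \<Rightarrow> 'a set) \<Rightarrow> enat" where
  "pt_pzf G \<omega> = (INF t\<in>{t. \<omega> t = verts G}. enat t)"

definition ept_from :: "('a, 'b) pre_digraph \<Rightarrow> 'a set \<Rightarrow> ennreal" where
  "ept_from G B = (\<integral>\<^sup>+\<omega>. ennreal_of_enat (pt_pzf G \<omega>) \<partial>pzf_process G B)"

definition ept :: "('a, 'b) pre_digraph \<Rightarrow> ennreal" where
  "ept G = Min ((\<lambda>v. ept_from G {v}) ` verts G)"

end

theory Submission
  imports Defs
begin

text \<open>
  Upper bound. Start from the universal vertex and let \<open>k\<close> of the \<open>n\<close> vertices be blue. The
  potential \<open>ln (1 + n - k) + ln (n / k)\<close> never increases, and it drops by at least \<open>1 / 10\<close> in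
  expectation in every round: while \<open>2 k \<le> n\<close> the blue set grows by a constant factor, so the second
  summand drops; afterwards every white vertex turns blue with probability at least \<open>1 / 2\<close>, so the
  first one does. Initially the potential is \<open>2 ln n\<close>, hence the expected time is at most \<open>20 ln n\<close>.

  Lower bound. For a blue vertex \<open>x\<close> the forcing probabilities sum to at most \<open>card (N[x] \<inter> C)\<close>, which
  is at most \<open>c + 2\<close> for \<open>x \<noteq> u\<close> and at most \<open>card C\<close> for \<open>x = u\<close>. So the expected number of blue
  vertices grows at most by the factor \<open>c + 4\<close> per round, and Markov's inequality with a union bound
  makes it unlikely that all vertices are blue within the first \<open>m\<close> rounds if \<open>(c + 4)^m \<le> n / 2\<close>.
\<close>

section \<open>The propagation time through the law of single rounds\<close>

text \<open>Marginal law of the blue set after \<open>t\<close> rounds, by Markov iteration of the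
  round kernel. Everything after this section works with these discrete laws instead of the measure
  on sequences.\<close>

primrec blue_pmf :: "('a, 'b) pre_digraph \<Rightarrow> 'a set \<Rightarrow> nat \<Rightarrow> 'a set pmf" where
  "blue_pmf G B 0 = return_pmf B"
| "blue_pmf G B (Suc t) = bind_pmf (blue_pmf G B t) (pzf_round G)"

text \<open>\<open>C 0 (Suc t)\<close> is \<open>C 0 t\<close> followed by \<open>eP t\<close>,
  which appends coordinate \<open>t\<close> drawn from the kernel; an integrand that sees only this
  coordinate is integrated by the kernel alone.\<close>

lemma nn_integral_pzf_C_step:
  fixes f :: "'a set \<Rightarrow> ennreal"
  shows "(\<integral>\<^sup>+\<omega>. f (\<omega> t) \<partial>Ionescu_Tulcea.C (pzf_kernel G B) (\<lambda>_. count_space UNIV) 0 (Suc t) (\<lambda>_. undefined)) =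
    (\<integral>\<^sup>+\<omega>. (\<integral>\<^sup>+x. f x \<partial>pzf_kernel G B t \<omega>) \<partial>Ionescu_Tulcea.C (pzf_kernel G B) (\<lambda>_. count_space UNIV) 0 t (\<lambda>_. undefined))"
proof -
  interpret Ionescu_Tulcea "pzf_kernel G B" "\<lambda>_. count_space UNIV"
    by (rule Ionescu_Tulcea_pzf_kernel)
  have meas: "(\<lambda>\<omega>. f (\<omega> t)) \<in> borel_measurable (Pi\<^sub>M {0..<Suc t} (\<lambda>_. count_space UNIV))"
    by (rule measurable_compose[OF measurable_component_singleton]) auto
  have sp: "(\<lambda>_. undefined) \<in> space (Pi\<^sub>M {0..<0::nat} (\<lambda>_. count_space (UNIV :: 'a set set)))"
    by (simp add: space_PiM)
  have eP: "eP t \<in> measurable (C 0 t (\<lambda>_. undefined)) (subprob_algebra (Pi\<^sub>M {0..<Suc t} (\<lambda>_. count_space UNIV)))"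
    using measurable_eP[of t] sets_C[OF sp, of t] by (simp cong: measurable_cong_sets)
  have "(\<integral>\<^sup>+\<omega>. f (\<omega> t) \<partial>C 0 (Suc t) (\<lambda>_. undefined)) =
     (\<integral>\<^sup>+\<omega>. (\<integral>\<^sup>+\<omega>'. f (\<omega>' t) \<partial>eP t \<omega>) \<partial>C 0 t (\<lambda>_. undefined))"
    using nn_integral_bind[OF meas eP] by simp
  also have "\<dots> = (\<integral>\<^sup>+\<omega>. (\<integral>\<^sup>+x. f x \<partial>pzf_kernel G B t \<omega>) \<partial>C 0 t (\<lambda>_. undefined))"
  proof (rule nn_integral_cong)
    fix \<omega> assume "\<omega> \<in> space (C 0 t (\<lambda>_. undefined))"
    then have "\<omega> \<in> space (Pi\<^sub>M {0..<t} (\<lambda>_. count_space UNIV))"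
      using space_C[OF sp, of t] by simp
    from nn_integral_eP[OF this meas]
    show "(\<integral>\<^sup>+\<omega>'. f (\<omega>' t) \<partial>eP t \<omega>) = (\<integral>\<^sup>+x. f x \<partial>pzf_kernel G B t \<omega>)" by simp
  qed
  finally show ?thesis .
qed

text \<open>The index is shifted because \<open>C 0 (Suc t)\<close> carries the coordinates
  \<open>0\<close> to \<open>t\<close>. Generality in \<open>f\<close> matters: the induction
  hypothesis is applied to the integral of \<open>f\<close> over one further round.\<close>

lemma nn_integral_pzf_C:
  fixes f :: "'a set \<Rightarrow> ennreal"
  shows "(\<integral>\<^sup>+\<omega>. f (\<omega> t) \<partial>Ionescu_Tulcea.C (pzf_kernel G B) (\<lambda>_. count_space UNIV) 0 (Suc t) (\<lambda>_. undefined)) =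
    (\<integral>\<^sup>+C. f C \<partial>blue_pmf G B t)"
proof (induction t arbitrary: f)
  interpret Ionescu_Tulcea "pzf_kernel G B" "\<lambda>_. count_space UNIV"
    by (rule Ionescu_Tulcea_pzf_kernel)
  case 0
  have "(\<integral>\<^sup>+\<omega>. c \<partial>C 0 0 (\<lambda>_. undefined)) = c" for c
    using prob_space.emeasure_space_1[OF prob_space_C, of "\<lambda>_. undefined" 0 0] by (simp add: space_PiM del: C.simps)
  then show ?case
    unfolding nn_integral_pzf_C_step by (simp add: pzf_kernel_def)
next
  case (Suc t)
  have "(\<integral>\<^sup>+\<omega>. f (\<omega> (Suc t)) \<partial>Ionescu_Tulcea.C (pzf_kernel G B) (\<lambda>_. count_space UNIV) 0 (Suc (Suc t)) (\<lambda>_. undefined)) =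
    (\<integral>\<^sup>+\<omega>. (\<integral>\<^sup>+x. f x \<partial>pzf_round G (\<omega> t)) \<partial>Ionescu_Tulcea.C (pzf_kernel G B) (\<lambda>_. count_space UNIV) 0 (Suc t) (\<lambda>_. undefined))"
    unfolding nn_integral_pzf_C_step[where f=f] by (simp add: pzf_kernel_def)
  also have "\<dots> = (\<integral>\<^sup>+C. (\<integral>\<^sup>+x. f x \<partial>pzf_round G C) \<partial>blue_pmf G B t)"
    by (rule Suc.IH)
  finally show ?case
    by (simp add: nn_integral_bind_pmf)
qed

lemma nn_integral_pzf_process:
  fixes f :: "'a set \<Rightarrow> ennreal"
  shows "(\<integral>\<^sup>+\<omega>. f (\<omega> t) \<partial>pzf_process G B) = (\<integral>\<^sup>+C. f C \<partial>blue_pmf G B t)"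
proof -
  interpret Ionescu_Tulcea "pzf_kernel G B" "\<lambda>_. count_space UNIV"
    by (rule Ionescu_Tulcea_pzf_kernel)
  let ?J = "{0..<Suc t}" and ?M = "\<lambda>J :: nat set. Pi\<^sub>M J (\<lambda>_. count_space (UNIV :: 'a set set))"
  \<comment> \<open>\<open>CI J\<close> is the image of \<open>C 0 (up_to J)\<close> under
    restriction to \<open>J\<close>; with this value of \<open>up_to\<close> the law of the
    coordinates up to \<open>t\<close> appears.\<close>
  have up: "up_to ?J = Suc t"
    by (rule antisym) (simp_all add: up_to_iff Suc_le_eq up_to_less)
  have sp: "(\<lambda>_. undefined) \<in> space (?M {0..<0})"
    by (simp add: space_PiM)
  have meas: "(\<lambda>\<omega>. f (\<omega> t)) \<in> borel_measurable (?M ?J)"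
    by (rule measurable_compose[OF measurable_component_singleton]) auto
  have r: "(\<lambda>\<omega>. restrict \<omega> ?J) \<in> measurable (?M UNIV) (?M ?J)"
    by (rule measurable_restrict_subset) simp
  have "(\<integral>\<^sup>+\<omega>. f (\<omega> t) \<partial>pzf_process G B) = (\<integral>\<^sup>+\<omega>. f (\<omega> t) \<partial>distr PF.lim (?M ?J) (\<lambda>\<omega>. restrict \<omega> ?J))"
    using meas r unfolding pzf_process_def
    by (subst nn_integral_distr) (auto cong: measurable_cong_sets)
  also have "\<dots> = (\<integral>\<^sup>+\<omega>. f (\<omega> t) \<partial>CI ?J)"
    by (subst distr_lim) auto
  also have "\<dots> = (\<integral>\<^sup>+\<omega>. f (\<omega> t) \<partial>C 0 (Suc t) (\<lambda>_. undefined))"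
    using meas sets_C[OF sp, of "Suc t"] unfolding CI_def up
    by (subst nn_integral_distr) (auto cong: measurable_cong_sets intro!: measurable_restrict_subset)
  finally show ?thesis
    by (simp only: nn_integral_pzf_C)
qed


section \<open>Bounds on the expected propagation time by sums over rounds\<close>

lemma borel_measurable_pzf_process:
  fixes f :: "'a set \<Rightarrow> ennreal"
  shows "(\<lambda>\<omega>. f (\<omega> t)) \<in> borel_measurable (pzf_process G B)"
proof -
  interpret Ionescu_Tulcea "pzf_kernel G B" "\<lambda>_. count_space UNIV"
    by (rule Ionescu_Tulcea_pzf_kernel)
  have "(\<lambda>\<omega>. f (\<omega> t)) \<in> borel_measurable (Pi\<^sub>M UNIV (\<lambda>_. count_space UNIV))"
    by (rule measurable_compose[OF measurable_component_singleton]) auto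
  then show ?thesis
    unfolding pzf_process_def by (simp cong: measurable_cong_sets)
qed

text \<open>Each round before the first full one contributes 1, and without a full round the sum
  diverges. Equality can fail for an arbitrary sequence, which may leave \<open>verts G\<close>
  again.\<close>

lemma pt_pzf_le_suminf:
  "ennreal_of_enat (pt_pzf G \<omega>) \<le> (\<Sum>t. indicator (- {verts G}) (\<omega> t))"
proof (cases "\<exists>t. \<omega> t = verts G")
  case True
  define T where "T = (LEAST t. \<omega> t = verts G)"
  have less: "\<omega> t \<noteq> verts G" if "t < T" for t
    using not_less_Least that unfolding T_def by blast
  have T: "\<omega> T = verts G" using True unfolding T_def by (rule LeastI_ex)
  then have "pt_pzf G \<omega> \<le> enat T"
    unfolding pt_pzf_def by (intro INF_lower) simp
  then have "ennreal_of_enat (pt_pzf G \<omega>) \<le> of_nat T"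
    using ennreal_of_enat_le_iff[of "pt_pzf G \<omega>" "enat T"] by (simp del: ennreal_of_enat_le_iff)
  also have "\<dots> = (\<Sum>t<T. indicator (- {verts G}) (\<omega> t))"
    using less by simp
  also have "\<dots> \<le> (\<Sum>t. indicator (- {verts G}) (\<omega> t))"
    by (rule sum_le_suminf) auto
  finally show ?thesis .
next
  case False
  then have "(\<Sum>t. indicator (- {verts G}) (\<omega> t)) = (\<Sum>t::nat. 1 :: ennreal)"
    by simp
  also have "\<dots> = top"
  proof (rule ccontr)
    assume "(\<Sum>t::nat. 1 :: ennreal) \<noteq> top"
    then obtain N :: nat where N: "(\<Sum>t::nat. 1 :: ennreal) < of_nat N"
      using ennreal_Ex_less_of_nat top.not_eq_extremum by blast
    have "(\<Sum>t<N. 1 :: ennreal) \<le> (\<Sum>t::nat. 1)"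
      by (rule sum_le_suminf) auto
    with N show False by simp
  qed
  finally show ?thesis by simp
qed

lemma ept_from_le_suminf:
  "ept_from G B \<le> (\<Sum>t. emeasure (blue_pmf G B t) (- {verts G}))"
proof -
  have "ept_from G B \<le> (\<integral>\<^sup>+\<omega>. (\<Sum>t. indicator (- {verts G}) (\<omega> t)) \<partial>pzf_process G B)"
    unfolding ept_from_def by (intro nn_integral_mono pt_pzf_le_suminf)
  also have "\<dots> = (\<Sum>t. \<integral>\<^sup>+\<omega>. indicator (- {verts G}) (\<omega> t) \<partial>pzf_process G B)"
    by (rule nn_integral_suminf) (rule borel_measurable_pzf_process)
  also have "\<dots> = (\<Sum>t. emeasure (blue_pmf G B t) (- {verts G}))"
    by (simp add: nn_integral_pzf_process)
  finally show ?thesis .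
qed

text \<open>Additive drift: every round that starts with a white vertex costs
  \<open>\<delta>\<close> of expected potential, and the potential cannot fall below 0. The drop is
  stated as a sum because subtraction on \<open>ennreal\<close> truncates. \<open>S\<close> is an
  invariant set of states on which the drop has to be checked.\<close>

lemma ept_from_le_potential:
  fixes \<Phi> :: "'a set \<Rightarrow> ennreal" and \<delta> :: ennreal
  assumes "B \<in> S"
    and closed: "\<And>C. C \<in> S \<Longrightarrow> set_pmf (pzf_round G C) \<subseteq> S"
    and drop: "\<And>C. C \<in> S \<Longrightarrow>
      (\<integral>\<^sup>+D. \<Phi> D \<partial>pzf_round G C) + \<delta> * indicator (- {verts G}) C \<le> \<Phi> C"
  shows "\<delta> * ept_from G B \<le> \<Phi> B"
proof -
  have S: "set_pmf (blue_pmf G B t) \<subseteq> S" for t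
    using \<open>B \<in> S\<close> closed by (induction t) (simp, fastforce)
  \<comment> \<open>Telescoped drift: the potential left after \<open>t\<close> rounds plus all that
    was paid so far.\<close>
  have sum: "(\<integral>\<^sup>+D. \<Phi> D \<partial>blue_pmf G B t) +
      (\<Sum>s<t. \<delta> * emeasure (blue_pmf G B s) (- {verts G})) \<le> \<Phi> B" for t
  proof (induction t)
    case (Suc t)
    have "(\<integral>\<^sup>+D. \<Phi> D \<partial>blue_pmf G B (Suc t)) + \<delta> * emeasure (blue_pmf G B t) (- {verts G}) =
        (\<integral>\<^sup>+C. (\<integral>\<^sup>+D. \<Phi> D \<partial>pzf_round G C) + \<delta> * indicator (- {verts G}) C \<partial>blue_pmf G B t)"
      by (simp add: nn_integral_bind_pmf nn_integral_add nn_integral_cmult)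
    also have "\<dots> \<le> (\<integral>\<^sup>+C. \<Phi> C \<partial>blue_pmf G B t)"
      using S[of t] drop by (intro nn_integral_mono_AE) (auto simp: AE_measure_pmf_iff)
    finally have "(\<integral>\<^sup>+D. \<Phi> D \<partial>blue_pmf G B (Suc t)) + \<delta> * emeasure (blue_pmf G B t) (- {verts G}) \<le>
        (\<integral>\<^sup>+C. \<Phi> C \<partial>blue_pmf G B t)" .
    from order_trans[OF add_right_mono[OF this] Suc.IH] show ?case
      by (simp only: sum.lessThan_Suc add.assoc) (simp only: add.commute)
  qed simp
  have "\<delta> * ept_from G B \<le> \<delta> * (\<Sum>t. emeasure (blue_pmf G B t) (- {verts G}))"
    by (intro mult_left_mono ept_from_le_suminf) simp
  also have "\<dots> = (\<Sum>t. \<delta> * emeasure (blue_pmf G B t) (- {verts G}))"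
    by simp
  also have "\<dots> \<le> \<Phi> B"
  proof (rule suminf_le_const)
    fix t show "(\<Sum>s<t. \<delta> * emeasure (blue_pmf G B s) (- {verts G})) \<le> \<Phi> B"
      by (rule order_trans[OF _ sum[of t]]) simp
  qed simp
  finally show ?thesis .
qed

text \<open>If none of the states \<open>0\<close> to \<open>m - 1\<close> is full, the propagation
  time is at least \<open>m\<close>; the union bound controls the complementary event. Truncated
  subtraction makes the bound trivial when the sum exceeds 1.\<close>

lemma ept_from_ge:
  "of_nat m * (1 - (\<Sum>t<m. emeasure (blue_pmf G B t) {verts G})) \<le> ept_from G B"
proof -
  \<comment> \<open>Indicator of the event that the first \<open>m\<close> states all have a white
    vertex, written as a product so that measurability follows coordinatewise.\<close>
  define g :: "(nat \<Rightarrow> 'a set) \<Rightarrow> ennreal" where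
    "g \<omega> = (\<Prod>t<m. indicator (- {verts G}) (\<omega> t))" for \<omega>
  have g: "g \<in> borel_measurable (pzf_process G B)"
    unfolding g_def by (intro borel_measurable_prod_ennreal borel_measurable_pzf_process)
  have "1 = (\<integral>\<^sup>+\<omega>. 1 \<partial>pzf_process G B)"
    using nn_integral_pzf_process[of _ _ "\<lambda>_. 1"] by simp
  also have "\<dots> \<le> (\<integral>\<^sup>+\<omega>. (\<Sum>t<m. indicator {verts G} (\<omega> t)) + g \<omega> \<partial>pzf_process G B)"
  proof (intro nn_integral_mono)
    fix \<omega> :: "nat \<Rightarrow> 'a set"
    show "1 \<le> (\<Sum>t<m. indicator {verts G} (\<omega> t)) + g \<omega>"
    proof (cases "\<exists>t<m. \<omega> t = verts G")
      case True
      then obtain t where "t < m" "\<omega> t = verts G" by auto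
      then have "1 \<le> (\<Sum>t<m. indicator {verts G} (\<omega> t) :: ennreal)"
        using member_le_sum[of t "{..<m}" "\<lambda>t. indicator {verts G} (\<omega> t) :: ennreal"] by simp
      then show ?thesis by (simp add: add_increasing2)
    next
      case False
      then have "g \<omega> = 1" unfolding g_def by (intro prod.neutral) auto
      then show ?thesis by simp
    qed
  qed
  also have "\<dots> = (\<integral>\<^sup>+\<omega>. (\<Sum>t<m. indicator {verts G} (\<omega> t)) \<partial>pzf_process G B) + (\<integral>\<^sup>+\<omega>. g \<omega> \<partial>pzf_process G B)"
    using g by (intro nn_integral_add borel_measurable_sum borel_measurable_pzf_process) auto
  also have "(\<integral>\<^sup>+\<omega>. (\<Sum>t<m. indicator {verts G} (\<omega> t)) \<partial>pzf_process G B) =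
      (\<Sum>t<m. emeasure (blue_pmf G B t) {verts G})"
    by (subst nn_integral_sum) (simp_all add: borel_measurable_pzf_process nn_integral_pzf_process)
  finally have "1 - (\<Sum>t<m. emeasure (blue_pmf G B t) {verts G}) \<le> (\<integral>\<^sup>+\<omega>. g \<omega> \<partial>pzf_process G B)"
    by (subst ennreal_minus_le_iff) (auto simp: add.commute)
  then have "of_nat m * (1 - (\<Sum>t<m. emeasure (blue_pmf G B t) {verts G})) \<le>
      of_nat m * (\<integral>\<^sup>+\<omega>. g \<omega> \<partial>pzf_process G B)"
    by (intro mult_left_mono) auto
  also have "\<dots> = (\<integral>\<^sup>+\<omega>. of_nat m * g \<omega> \<partial>pzf_process G B)"
    using g by (simp add: nn_integral_cmult)
  also have "\<dots> \<le> ept_from G B"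
    unfolding ept_from_def
  proof (intro nn_integral_mono)
    fix \<omega> :: "nat \<Rightarrow> 'a set"
    show "of_nat m * g \<omega> \<le> ennreal_of_enat (pt_pzf G \<omega>)"
    proof (cases "\<exists>t<m. \<omega> t = verts G")
      case True
      then have "g \<omega> = 0" unfolding g_def by (auto intro!: prod_zero bexI simp: indicator_def)
      then show ?thesis by simp
    next
      case False
      then have "enat m \<le> pt_pzf G \<omega>"
        unfolding pt_pzf_def by (intro INF_greatest) (auto simp: not_less[symmetric])
      then have "of_nat m \<le> ennreal_of_enat (pt_pzf G \<omega>)"
        using ennreal_of_enat_le_iff[of "enat m" "pt_pzf G \<omega>"] by (simp del: ennreal_of_enat_le_iff)
      moreover have "g \<omega> \<le> 1" unfolding g_def by (intro prod_le_1) (auto split: split_indicator)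
      ultimately show ?thesis
        using mult_left_mono[of "g \<omega>" 1 "of_nat m"] by (auto intro: order_trans)
    qed
  qed
  finally show ?thesis .
qed

section \<open>Growth of the expected number of blue vertices\<close>

text \<open>Out-degree counts arcs; without parallel arcs, \<open>head\<close> is injective on the
  arcs leaving \<open>x\<close>.\<close>

lemma (in graph) card_nbrs: "card {w. x \<rightarrow>\<^bsub>G\<^esub> w} = out_degree G x"
proof -
  have "inj_on (head G) (out_arcs G x)"
    by (auto simp: inj_on_def arc_to_ends_def intro!: no_multi_arcs)
  moreover have "head G ` out_arcs G x = {w. x \<rightarrow>\<^bsub>G\<^esub> w}"
    by (auto simp: arcs_ends_conv)
  ultimately show ?thesis
    unfolding out_degree_def by (metis card_image)
qed

lemma (in graph) finite_nbrs: "finite {w. x \<rightarrow>\<^bsub>G\<^esub> w}"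
  by (rule finite_subset[OF _ finite_verts]) (auto dest: adj_in_verts)

lemma (in graph) finite_attempts: "finite (attempts G C)"
  by (rule finite_subset[of _ "verts G \<times> verts G"]) (auto simp: attempts_def dest: adj_in_verts)

text \<open>The white neighbour \<open>w\<close> is missing from the blue part of the closed
  neighborhood, which compensates for \<open>x\<close> itself.\<close>

lemma (in graph) force_prob_le_1:
  assumes "(x, w) \<in> attempts G C"
  shows "force_prob G C x \<le> 1"
proof -
  have w: "x \<in> C" "w \<notin> C" "x \<rightarrow>\<^bsub>G\<^esub> w" using assms by (auto simp: attempts_def)
  have "closed_nbhd G x \<inter> C \<subseteq> insert x ({w. x \<rightarrow>\<^bsub>G\<^esub> w} - {w})"
    using w by (auto simp: closed_nbhd_def)
  then have "card (closed_nbhd G x \<inter> C) \<le> card (insert x ({w. x \<rightarrow>\<^bsub>G\<^esub> w} - {w}))"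
    by (intro card_mono) (auto simp: finite_nbrs)
  also have "\<dots> \<le> Suc (card ({w. x \<rightarrow>\<^bsub>G\<^esub> w} - {w}))"
    by (simp add: card_insert_if finite_nbrs)
  also have "\<dots> = card {w. x \<rightarrow>\<^bsub>G\<^esub> w}"
    using w by (intro card_Suc_Diff1) (auto simp: finite_nbrs)
  finally show ?thesis
    by (auto simp: force_prob_def card_nbrs divide_le_eq_1)
qed

lemma force_prob_nonneg: "0 \<le> force_prob G C x"
  by (simp add: force_prob_def)

lemma (in graph) nn_integral_attempt:
  assumes "(x, w) \<in> attempts G C"
  shows "(\<integral>\<^sup>+s. of_bool (s (x, w)) \<partial>Pi_pmf (attempts G C) False (\<lambda>(x, w). bernoulli_pmf (force_prob G C x))) =
    ennreal (force_prob G C x)"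
proof -
  let ?M = "Pi_pmf (attempts G C) False (\<lambda>(x, w). bernoulli_pmf (force_prob G C x))"
  have "(\<integral>\<^sup>+s. of_bool (s (x, w)) \<partial>?M) = (\<integral>\<^sup>+b. of_bool b \<partial>map_pmf (\<lambda>s. s (x, w)) ?M)"
    by simp
  also have "map_pmf (\<lambda>s. s (x, w)) ?M = bernoulli_pmf (force_prob G C x)"
    using assms by (simp add: Pi_pmf_component finite_attempts)
  finally show ?thesis
    using force_prob_le_1[OF assms] by (simp add: force_prob_nonneg)
qed

text \<open>The new blue vertices are at most as many as the successful attempts. A blue
  \<open>x\<close> makes at most \<open>out_degree G x\<close> attempts, so the degree cancels
  against the denominator of the forcing probability.\<close>

lemma (in graph) nn_integral_card_pzf_round:
  assumes "finite C"
  shows "(\<integral>\<^sup>+D. of_nat (card D) \<partial>pzf_round G C) \<le>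
    ennreal (real (card C) + (\<Sum>x\<in>C. real (card (closed_nbhd G x \<inter> C))))"
proof -
  let ?M = "Pi_pmf (attempts G C) False (\<lambda>(x, w). bernoulli_pmf (force_prob G C x))"
  have "(\<integral>\<^sup>+D. of_nat (card D) \<partial>pzf_round G C) \<le>
     (\<integral>\<^sup>+s. of_nat (card C) + (\<Sum>e\<in>attempts G C. of_bool (s e)) \<partial>?M)"
    unfolding pzf_round_def nn_integral_map_pmf
  proof (intro nn_integral_mono)
    fix s
    have "{w. \<exists>x. (x, w) \<in> attempts G C \<and> s (x, w)} = snd ` (attempts G C \<inter> {e. s e})"
      by force
    then have "card {w. \<exists>x. (x, w) \<in> attempts G C \<and> s (x, w)} \<le> card (attempts G C \<inter> {e. s e})"
      by (simp add: card_image_le finite_attempts)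
    also have "\<dots> = (\<Sum>e\<in>attempts G C. of_bool (s e))"
      by (simp add: finite_attempts)
    finally have "card (C \<union> {w. \<exists>x. (x, w) \<in> attempts G C \<and> s (x, w)}) \<le>
        card C + (\<Sum>e\<in>attempts G C. of_bool (s e))"
      by (intro order_trans[OF card_Un_le] add_left_mono)
    then have "(of_nat (card (C \<union> {w. \<exists>x. (x, w) \<in> attempts G C \<and> s (x, w)})) :: ennreal) \<le>
        of_nat (card C + (\<Sum>e\<in>attempts G C. of_bool (s e)))"
      by (rule of_nat_mono)
    then show "of_nat (card (C \<union> {w. \<exists>x. (x, w) \<in> attempts G C \<and> s (x, w)})) \<le>
        (of_nat (card C) + (\<Sum>e\<in>attempts G C. of_bool (s e)) :: ennreal)"
      by (simp only: of_nat_add of_nat_sum of_nat_of_bool)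
  qed
  also have "\<dots> = of_nat (card C) + (\<Sum>e\<in>attempts G C. \<integral>\<^sup>+s. of_bool (s e) \<partial>?M)"
    by (simp add: nn_integral_add nn_integral_sum)
  also have "(\<Sum>e\<in>attempts G C. \<integral>\<^sup>+s. of_bool (s e) \<partial>?M) = (\<Sum>(x, w)\<in>attempts G C. ennreal (force_prob G C x))"
    using nn_integral_attempt by (intro sum.cong) auto
  also have "\<dots> = ennreal (\<Sum>(x, w)\<in>attempts G C. force_prob G C x)"
    by (subst sum_ennreal[symmetric]) (auto simp: force_prob_nonneg case_prod_beta)
  also have "(\<Sum>(x, w)\<in>attempts G C. force_prob G C x) = (\<Sum>x\<in>C. \<Sum>w\<in>{w. x \<rightarrow>\<^bsub>G\<^esub> w \<and> w \<notin> C}. force_prob G C x)"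
  proof -
    have "attempts G C = (SIGMA x:C. {w. x \<rightarrow>\<^bsub>G\<^esub> w \<and> w \<notin> C})"
      by (auto simp: attempts_def)
    moreover have "finite {w. x \<rightarrow>\<^bsub>G\<^esub> w \<and> w \<notin> C}" for x
      by (rule finite_subset[OF _ finite_nbrs[of x]]) auto
    ultimately show ?thesis
      using assms by (subst sum.Sigma) auto
  qed
  also have "of_nat (card C) + ennreal \<dots> = ennreal (real (card C) + \<dots>)"
    by (subst ennreal_plus) (auto intro!: sum_nonneg simp: force_prob_nonneg ennreal_of_nat_eq_real_of_nat)
  also have "\<dots> \<le> ennreal (real (card C) + (\<Sum>x\<in>C. real (card (closed_nbhd G x \<inter> C))))"
  proof (intro ennreal_leI add_left_mono sum_mono)
    fix x
    have "card {w. x \<rightarrow>\<^bsub>G\<^esub> w \<and> w \<notin> C} \<le> out_degree G x"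
      unfolding card_nbrs[symmetric] by (intro card_mono finite_nbrs) auto
    then have "real (card {w. x \<rightarrow>\<^bsub>G\<^esub> w \<and> w \<notin> C}) * force_prob G C x \<le> real (out_degree G x) * force_prob G C x"
      by (intro mult_right_mono) (auto simp: force_prob_nonneg)
    \<comment> \<open>Only an inequality: at degree 0 the quotient, and hence the left side, is
      0.\<close>
    also have "\<dots> \<le> real (card (closed_nbhd G x \<inter> C))"
      by (simp add: force_prob_def)
    finally show "(\<Sum>w\<in>{w. x \<rightarrow>\<^bsub>G\<^esub> w \<and> w \<notin> C}. force_prob G C x) \<le> real (card (closed_nbhd G x \<inter> C))"
      by simp
  qed
  finally show ?thesis .
qed

text \<open>Deleting \<open>u\<close> costs \<open>x\<close> at most one neighbor, namely
  \<open>u\<close>.\<close>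

lemma out_degree_le_del_vert:
  assumes "graph G" "pre_digraph.del_vert G u \<in> bounded_degree_graphs c" "x \<in> verts G" "x \<noteq> u"
  shows "out_degree G x \<le> c + 1"
proof -
  interpret graph G by fact
  let ?H = "pre_digraph.del_vert G u"
  interpret H: graph ?H using assms(2) by (simp add: bounded_degree_graphs_def)
  have "out_degree ?H x \<le> max_degree ?H"
    unfolding max_degree_def using assms by (intro Max_ge) (auto simp: verts_del_vert)
  then have *: "out_degree ?H x \<le> c"
    using assms(2) by (simp add: bounded_degree_graphs_def)
  have "{w. x \<rightarrow>\<^bsub>G\<^esub> w} \<subseteq> insert u {w. x \<rightarrow>\<^bsub>?H\<^esub> w}"
    using assms(4) by (auto simp: arcs_ends_conv del_vert_simps image_iff) 
  then have "card {w. x \<rightarrow>\<^bsub>G\<^esub> w} \<le> card (insert u {w. x \<rightarrow>\<^bsub>?H\<^esub> w})"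
    by (intro card_mono) (auto simp: H.finite_nbrs)
  also have "\<dots> \<le> Suc (card {w. x \<rightarrow>\<^bsub>?H\<^esub> w})"
    by (simp add: card_insert_if H.finite_nbrs)
  finally show ?thesis
    using * by (simp add: card_nbrs H.card_nbrs)
qed

text \<open>The factor \<open>c + 4\<close> is 1 for the blue set itself, 1 for the forces of
  \<open>u\<close>, and \<open>c + 2\<close> for the size of a closed neighborhood of any other
  vertex.\<close>

lemma nn_integral_card_pzf_round_le:
  assumes "graph G" "pre_digraph.del_vert G u \<in> bounded_degree_graphs c" "C \<subseteq> verts G"
  shows "(\<integral>\<^sup>+D. of_nat (card D) \<partial>pzf_round G C) \<le> of_nat (c + 4) * of_nat (card C)"
proof -
  interpret graph G by fact
  have fin: "finite C" using assms(3) finite_verts by (rule finite_subset)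
  have "(\<Sum>x\<in>C. card (closed_nbhd G x \<inter> C)) \<le> (\<Sum>x\<in>C. (if x = u then card C else 0) + (c + 2))"
  proof (rule sum_mono)
    fix x assume x: "x \<in> C"
    show "card (closed_nbhd G x \<inter> C) \<le> (if x = u then card C else 0) + (c + 2)"
    proof (cases "x = u")
      case True
      then show ?thesis using card_mono[OF fin, of "closed_nbhd G x \<inter> C"] by simp
    next
      case False
      have "card (closed_nbhd G x \<inter> C) \<le> card (insert x {w. x \<rightarrow>\<^bsub>G\<^esub> w})"
        by (intro card_mono) (auto simp: closed_nbhd_def finite_nbrs)
      also have "\<dots> \<le> Suc (out_degree G x)"
        by (simp add: card_insert_if finite_nbrs card_nbrs)
      finally show ?thesis
        using out_degree_le_del_vert[OF assms(1,2), of x] x assms(3) False by auto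
    qed
  qed
  also have "\<dots> = (\<Sum>x\<in>C. (if x = u then card C else 0)) + (c + 2) * card C"
    by (subst sum.distrib) simp
  also have "(\<Sum>x\<in>C. (if x = u then card C else 0)) \<le> card C"
    using fin by simp
  finally have "card C + (\<Sum>x\<in>C. card (closed_nbhd G x \<inter> C)) \<le> (c + 4) * card C"
    by (simp add: algebra_simps)
  then have "real (card C + (\<Sum>x\<in>C. card (closed_nbhd G x \<inter> C))) \<le> real ((c + 4) * card C)"
    by (simp only: of_nat_mono)
  then have "real (card C) + (\<Sum>x\<in>C. real (card (closed_nbhd G x \<inter> C))) \<le> real ((c + 4) * card C)"
    by (simp only: of_nat_add of_nat_sum)
  then have "ennreal (real (card C) + (\<Sum>x\<in>C. real (card (closed_nbhd G x \<inter> C)))) \<le> of_nat (c + 4) * of_nat (card C)"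
    by (metis ennreal_leI ennreal_of_nat_eq_real_of_nat of_nat_mult)
  then show ?thesis
    using nn_integral_card_pzf_round[OF fin] by (rule order_trans[rotated])
qed

section \<open>Expected drop of the potential\<close>

text \<open>The first summand counts white vertices plus one, so that its logarithm stays
  nonnegative and the potential is 0 at the full blue set.\<close>

definition potential :: "('a, 'b) pre_digraph \<Rightarrow> 'a set \<Rightarrow> real" where
  "potential G C = ln (1 + real (card (verts G)) - real (card C)) + ln (real (card (verts G)) / real (card C))"

text \<open>
  The exponential on the right makes the expectation computable: with \<open>x = X / k\<close> for the number \<open>X\<close>
  of vertices forced by \<open>u\<close>, it factorises over the independent attempts.
\<close>

lemma neg_ln_le_exp:
  fixes x :: real
  assumes "0 \<le> x"
  shows "- ln (1 + x) \<le> (exp (- x) - 1) / 2"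
proof -
  \<comment> \<open>This rational bound produces the factor 1/2: \<open>1 / (1 + x) - 1\<close> is
    exactly half of \<open>(1 - x) / (1 + x) - 1\<close>.\<close>
  have e: "(1 - x) / (1 + x) \<le> exp (- x)"
  proof (cases "x \<le> 1")
    case True
    then have "(1 - x) / (1 + x) \<le> (1 - x) / 1"
      using assms by (intro divide_left_mono) auto
    also have "\<dots> \<le> exp (- x)"
      using exp_ge_add_one_self[of "- x"] by simp
    finally show ?thesis .
  next
    case False
    then have "(1 - x) / (1 + x) \<le> 0"
      by (intro divide_nonpos_pos) auto
    then show ?thesis by (rule order_trans) simp
  qed
  have "- ln (1 + x) = ln (1 / (1 + x))"
    using assms by (simp add: ln_div)
  also have "\<dots> \<le> 1 / (1 + x) - 1"
    using assms by (intro ln_le_minus_one) simp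
  also have "\<dots> = ((1 - x) / (1 + x) - 1) / 2"
    using assms by (simp add: field_simps)
  finally show ?thesis using e by simp
qed

lemma one_minus_exp_neg_inverse_ge:
  fixes k :: real
  assumes "1 \<le> k"
  shows "1 - exp (- 1 / k) \<ge> 1 / (k + 1)"
proof -
  have "1 + 1 / k \<le> exp (1 / k)" by simp
  then have "exp (- 1 / k) \<le> 1 / (1 + 1 / k)"
    using assms by (simp add: exp_minus inverse_eq_divide frac_le add_pos_nonneg)
  also have "\<dots> = 1 - 1 / (k + 1)"
    using assms by (simp add: field_simps)
  finally show ?thesis by simp
qed

text \<open>Here \<open>k\<close> and \<open>l\<close> are the old and new numbers of blue vertices
  and \<open>x\<close> those forced by \<open>u\<close>. The drop comes from the second logarithm;
  the first one only decreases.\<close>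

lemma potential_drop_small:
  fixes n k l x :: real
  assumes "1 \<le> k" "0 \<le> x" "k + x \<le> l" "l \<le> n"
  shows "ln (1 + n - l) + ln (n / l) \<le> ln (1 + n - k) + ln (n / k) + (exp (- x / k) - 1) / 2"
proof -
  have "ln (1 + n - l) \<le> ln (1 + n - k)" "ln (k + x) \<le> ln l"
    using assms by simp_all
  moreover have "ln (k + x) = ln k + ln (1 + x / k)"
  proof -
    have "k + x = k * (1 + x / k)" using assms by (simp add: field_simps)
    moreover have "0 < 1 + x / k" using assms by (simp add: add_pos_nonneg)
    ultimately show ?thesis using assms ln_mult_pos[of k "1 + x / k"] by simp
  qed
  moreover have "- ln (1 + x / k) \<le> (exp (- x / k) - 1) / 2"
    using assms neg_ln_le_exp[of "x / k"] by simp
  moreover have "ln (n / l) = ln n - ln l" "ln (n / k) = ln n - ln k"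
    using assms by (simp_all add: ln_div)
  ultimately show ?thesis by linarith
qed

text \<open>Now the drop comes from the first logarithm, by \<open>ln y \<le> y - 1\<close> at the
  ratio of its new and old arguments.\<close>

lemma potential_drop_large:
  fixes n k l x :: real
  assumes "1 \<le> k" "0 \<le> x" "k + x \<le> l" "l \<le> n"
  shows "ln (1 + n - l) + ln (n / l) \<le> ln (1 + n - k) + ln (n / k) - x / (1 + n - k)"
proof -
  have "ln (1 + n - l) - ln (1 + n - k) = ln ((1 + n - l) / (1 + n - k))"
    using assms by (simp add: ln_div)
  also have "\<dots> \<le> (1 + n - l) / (1 + n - k) - 1"
    using assms by (intro ln_le_minus_one divide_pos_pos) auto
  also have "\<dots> = - ((l - k) / (1 + n - k))"
    using assms by (simp add: field_simps)
  also have "\<dots> \<le> - (x / (1 + n - k))"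
    using assms by (intro le_imp_neg_le divide_right_mono) auto
  finally have "ln (1 + n - l) - ln (1 + n - k) \<le> - (x / (1 + n - k))" .
  moreover have "ln (n / l) \<le> ln (n / k)"
    using assms by (simp add: ln_div)
  ultimately show ?thesis by simp
qed

lemma expectation_bernoulli_if:
  fixes q a :: real
  assumes "0 \<le> q" "q \<le> 1"
  shows "measure_pmf.expectation (bernoulli_pmf q) (\<lambda>b. if b then a else 1) = 1 - q * (1 - a)"
  using assms by (simp add: algebra_simps)

section \<open>One round in which the universal vertex is blue and some vertex is white\<close>

locale blue_universal = graph G for G :: "('a, 'b) pre_digraph" +
  fixes u :: 'a and C :: "'a set"
  assumes univ: "universal_vertex G u" and uC: "u \<in> C" and C: "C \<subset> verts G"
begin

abbreviation "n \<equiv> card (verts G)"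
abbreviation "k \<equiv> card C"
abbreviation "M \<equiv> Pi_pmf (attempts G C) False (\<lambda>(x, w). bernoulli_pmf (force_prob G C x))"
text \<open>Only successes of \<open>u\<close> are counted: they are independent with the common
  probability \<open>p\<close>. Forces by other vertices can only enlarge the next blue set
  \<open>F s\<close>.\<close>

abbreviation "X s \<equiv> (\<Sum>w\<in>verts G - C. of_bool (s (u, w)) :: real)"
abbreviation "F s \<equiv> C \<union> {w. \<exists>x. (x, w) \<in> attempts G C \<and> s (x, w)}"
abbreviation "p \<equiv> real k / (real n - 1)"

lemma finite_blue: "finite C" using C finite_verts by (metis finite_subset psubset_imp_subset)

lemma k_bounds: "1 \<le> k" "k < n"
  using finite_blue uC psubset_card_mono[OF finite_verts C] by (auto simp: Suc_le_eq card_gt_0_iff)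

lemma attempts_u: "w \<in> verts G - C \<Longrightarrow> (u, w) \<in> attempts G C"
  using univ uC by (auto simp: attempts_def universal_vertex_def)

lemma force_prob_u: "force_prob G C u = p"
proof -
  have "closed_nbhd G u = verts G"
    using univ by (auto simp: closed_nbhd_def universal_vertex_def dest: adj_in_verts)
  then have "closed_nbhd G u \<inter> C = C" using C by auto
  moreover have "{w. u \<rightarrow>\<^bsub>G\<^esub> w} = verts G - {u}"
    using univ by (auto simp: universal_vertex_def dest: adj_in_verts adj_not_same)
  then have "out_degree G u = n - 1"
    using univ by (simp add: card_nbrs[symmetric] universal_vertex_def)
  ultimately show ?thesis
    using k_bounds by (simp add: force_prob_def of_nat_diff)
qed

lemma p_bounds: "0 \<le> p" "p \<le> 1"
  using k_bounds by (auto simp: divide_le_eq_1)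

lemma card_white: "real (card (verts G - C)) = real n - real k"
  using C finite_blue k_bounds by (subst card_Diff_subset) (auto simp: of_nat_diff)

lemma card_next: "real k + X s \<le> real (card (F s))" "card (F s) \<le> n"
proof -
  have sub: "F s \<subseteq> verts G" using C by (auto simp: attempts_def dest: adj_in_verts)
  then show "card (F s) \<le> n" by (rule card_mono[OF finite_verts])
  have "C \<union> ((verts G - C) \<inter> {w. s (u, w)}) \<subseteq> F s"
    using attempts_u by auto
  then have "card (C \<union> ((verts G - C) \<inter> {w. s (u, w)})) \<le> card (F s)"
    using sub finite_verts by (meson card_mono finite_subset)
  also have "card (C \<union> ((verts G - C) \<inter> {w. s (u, w)})) = k + card ((verts G - C) \<inter> {w. s (u, w)})"
    using finite_blue by (intro card_Un_disjoint) auto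
  finally have "real (k + card ((verts G - C) \<inter> {w. s (u, w)})) \<le> real (card (F s))"
    by (simp only: of_nat_mono)
  then show "real k + X s \<le> real (card (F s))" by simp
qed

lemma X_nonneg: "0 \<le> X s" by (intro sum_nonneg) auto

lemma finite_M: "finite (set_pmf M)"
  by (simp add: set_Pi_pmf finite_attempts) (rule finite_PiE_dflt; simp add: finite_attempts)

lemma integrable_M: "integrable M (f :: _ \<Rightarrow> real)"
  by (rule integrable_measure_pmf_finite[OF finite_M])

lemma expectation_affine:
  "measure_pmf.expectation M (\<lambda>s. a + (g s - 1) / 2) = a + (measure_pmf.expectation M g - 1) / (2 :: real)"
  by (simp add: integrable_M)

lemma map_pmf_attempt:
  assumes "w \<in> verts G - C"
  shows "map_pmf (\<lambda>s. s (u, w)) M = bernoulli_pmf p"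
  using attempts_u[OF assms] by (simp add: Pi_pmf_component finite_attempts force_prob_u)

lemma expectation_X: "measure_pmf.expectation M X = p * (real n - real k)"
proof -
  have "measure_pmf.expectation M (\<lambda>s. of_bool (s (u, w))) = p" if "w \<in> verts G - C" for w
  proof -
    have "measure_pmf.expectation M (\<lambda>s. of_bool (s (u, w))) =
        measure_pmf.expectation (map_pmf (\<lambda>s. s (u, w)) M) (of_bool :: bool \<Rightarrow> real)"
      by (rule integral_map_pmf[symmetric])
    then show ?thesis
      unfolding map_pmf_attempt[OF that] using p_bounds by simp
  qed
  then have "measure_pmf.expectation M X = (\<Sum>w\<in>verts G - C. p)"
    by (subst Bochner_Integration.integral_sum) (auto intro: integrable_M)
  then show ?thesis by (simp add: card_white)
qed

text \<open>Exponential moment of a binomial variable: independence gives the factor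
  \<open>1 - p * (1 - exp (- 1 / k))\<close> for each white vertex, and
  \<open>1 - y \<le> exp (- y)\<close> turns the product into an exponential.\<close>

lemma expectation_exp_X:
  "measure_pmf.expectation M (\<lambda>s. exp (- X s / k)) \<le> exp (- (p * (real n - real k) / (real k + 1)))"
proof -
  \<comment> \<open>The product rule for \<open>Pi_pmf\<close> runs over all attempts, so attempts
    of other vertices get the constant factor 1.\<close>
  define f :: "'a \<times> 'a \<Rightarrow> bool \<Rightarrow> real" where
    "f e b = (if fst e = u \<and> b then exp (- 1 / k) else 1)" for e b
  let ?A = "(\<lambda>w. (u, w)) ` (verts G - C)"
  have inj: "inj_on (\<lambda>w. (u, w)) (verts G - C)" by (auto simp: inj_on_def)
  have A: "?A \<subseteq> attempts G C" using attempts_u by auto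
  have out: "fst e \<noteq> u" if "e \<in> attempts G C - ?A" for e
    using that by (auto simp: attempts_def dest: adj_in_verts)
  have fu: "f (u, w) = (\<lambda>b. if b then exp (- 1 / k) else 1)" for w
    by (simp add: f_def fun_eq_iff)
  have out': "f e = (\<lambda>_. 1)" if "e \<in> attempts G C - ?A" for e
    using out[OF that] by (simp add: f_def fun_eq_iff)
  have "exp (- X s / k) = (\<Prod>e\<in>attempts G C. f e (s e))" for s
  proof -
    have "(\<Prod>e\<in>attempts G C. f e (s e)) = (\<Prod>e\<in>?A. f e (s e))"
      using out by (intro prod.mono_neutral_right finite_attempts A) (auto simp: out')
    also have "\<dots> = (\<Prod>w\<in>verts G - C. exp (- of_bool (s (u, w)) / k))"
      by (subst prod.reindex[OF inj]) (auto intro!: prod.cong simp: f_def)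
    also have "\<dots> = exp (\<Sum>w\<in>verts G - C. - of_bool (s (u, w)) / k)"
      by (simp only: exp_sum finite_Diff finite_verts)
    also have "(\<Sum>w\<in>verts G - C. - of_bool (s (u, w)) / k) = - X s / k"
      by (simp only: sum_negf sum_divide_distrib[symmetric])
    finally show ?thesis by simp
  qed
  then have "measure_pmf.expectation M (\<lambda>s. exp (- X s / k)) =
      measure_pmf.expectation M (\<lambda>s. \<Prod>e\<in>attempts G C. f e (s e))"
    by simp
  also have "\<dots> = (\<Prod>e\<in>attempts G C. measure_pmf.expectation ((\<lambda>(x, w). bernoulli_pmf (force_prob G C x)) e) (f e))"
    by (rule expectation_prod_Pi_pmf)
       (auto simp: finite_attempts f_def intro!: integrable_measure_pmf_finite)
  also have "\<dots> = (\<Prod>e\<in>?A. measure_pmf.expectation ((\<lambda>(x, w). bernoulli_pmf (force_prob G C x)) e) (f e))"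
    using out by (intro prod.mono_neutral_right finite_attempts A) (auto simp: out')
  also have "\<dots> = (\<Prod>w\<in>verts G - C. measure_pmf.expectation (bernoulli_pmf p) (f (u, w)))"
    by (subst prod.reindex[OF inj]) (simp add: force_prob_u)
  also have "\<dots> = (\<Prod>w\<in>verts G - C. 1 - p * (1 - exp (- 1 / k)))"
    by (simp only: fu expectation_bernoulli_if[OF p_bounds])
  also have "\<dots> \<le> (\<Prod>w\<in>verts G - C. exp (- (p / (real k + 1))))"
  proof (intro prod_mono conjI)
    have e: "1 / (real k + 1) \<le> 1 - exp (- 1 / k)"
      using k_bounds one_minus_exp_neg_inverse_ge[of "real k"] by simp
    have "p * (1 - exp (- 1 / k)) \<le> 1 * 1"
      using p_bounds by (intro mult_mono) auto
    then show "0 \<le> 1 - p * (1 - exp (- 1 / k))" by simp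
    have "p * (1 / (real k + 1)) \<le> p * (1 - exp (- 1 / k))"
      using p_bounds e by (intro mult_left_mono) auto
    then show "1 - p * (1 - exp (- 1 / k)) \<le> exp (- (p / (real k + 1)))"
      using exp_ge_add_one_self[of "- (p / (real k + 1))"] by simp
  qed
  also have "\<dots> = exp (- (p * (real n - real k) / (real k + 1)))"
    by (simp add: card_white[symmetric] exp_of_nat_mult[symmetric] algebra_simps)
  finally show ?thesis .
qed

lemma potential_next_small: "potential G (F s) \<le> potential G C + (exp (- X s / k) - 1) / 2"
  using card_next[of s] k_bounds X_nonneg[of s] unfolding potential_def
  by (intro potential_drop_small) simp_all

lemma potential_next_large: "potential G (F s) \<le> potential G C - X s / (1 + real n - real k)"
  using card_next[of s] k_bounds X_nonneg[of s] unfolding potential_def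
  by (intro potential_drop_large) simp_all

lemma expectation_potential_drop: "measure_pmf.expectation M (\<lambda>s. potential G (F s)) \<le> potential G C - 1 / 10"
proof (cases "2 * k \<le> n")
  case True
  have k: "1 \<le> real k" "real k < real n" "2 * real k \<le> real n"
    using k_bounds True by (simp_all add: of_nat_mono flip: of_nat_mult)
  \<comment> \<open>Uses \<open>k + 1 \<le> 2 * k\<close> and \<open>n \<le> 2 * (n - k)\<close>.
    Then the exponential moment is at most \<open>exp (- 1 / 4) \<le> 4 / 5\<close>, and
    \<open>(4 / 5 - 1) / 2\<close> is the drop of 1/10.\<close>
  have "1 / 4 \<le> p * (real n - real k) / (real k + 1)"
  proof -
    have "(real n - 1) * (real k + 1) \<le> real n * (2 * real k)"
      using k by (intro mult_mono) auto
    also have "\<dots> \<le> 4 * (real k * (real n - real k))"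
      using k mult_left_mono[of "2 * real k" "real n" "real k"] by (simp add: algebra_simps)
    finally have "1 / 4 * ((real n - 1) * (real k + 1)) \<le> real k * (real n - real k)"
      by simp
    moreover have "0 < (real n - 1) * (real k + 1)"
      using k by simp
    ultimately have "1 / 4 \<le> real k * (real n - real k) / ((real n - 1) * (real k + 1))"
      by (simp only: le_divide_eq if_True)
    then show ?thesis by simp
  qed
  then have "exp (- (p * (real n - real k) / (real k + 1))) \<le> exp (- (1 / 4))"
    by simp
  also have "\<dots> \<le> 4 / 5"
    using exp_ge_add_one_self[of "1 / 4 :: real"] by (simp add: exp_minus field_simps)
  finally have e: "measure_pmf.expectation M (\<lambda>s. exp (- X s / k)) \<le> 4 / 5"
    using expectation_exp_X by simp
  have "measure_pmf.expectation M (\<lambda>s. potential G (F s)) \<le>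
      measure_pmf.expectation M (\<lambda>s. potential G C + (exp (- X s / k) - 1) / 2)"
    by (intro integral_mono integrable_M potential_next_small)
  also have "\<dots> = potential G C + (measure_pmf.expectation M (\<lambda>s. exp (- X s / k)) - 1) / 2"
    by (rule expectation_affine)
  finally have "measure_pmf.expectation M (\<lambda>s. potential G (F s)) \<le>
      potential G C + (measure_pmf.expectation M (\<lambda>s. exp (- X s / k)) - 1) / 2" .
  moreover have "a \<le> b - 1 / 10" if "a \<le> b + (e - 1) / 2" "e \<le> 4 / 5" for a b e :: real
    using that by (simp add: field_simps)
  ultimately show ?thesis using e by blast
next
  case False
  have k: "1 \<le> real k" "real k < real n" "real n < 2 * real k" "1 \<le> real n - real k"
    using k_bounds False by (simp_all flip: of_nat_diff) 
  have "measure_pmf.expectation M (\<lambda>s. potential G (F s)) \<le>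
      measure_pmf.expectation M (\<lambda>s. potential G C - X s / (1 + real n - real k))"
    by (intro integral_mono integrable_M potential_next_large)
  also have "\<dots> = potential G C - measure_pmf.expectation M X / (1 + real n - real k)"
    by (subst Bochner_Integration.integral_diff) (simp_all add: integrable_M)
  also have "\<dots> = potential G C - p * ((real n - real k) / (1 + real n - real k))"
    by (simp only: expectation_X times_divide_eq_right)
  \<comment> \<open>Both factors are at least 1/2: \<open>p\<close> because
    \<open>n < 2 * k\<close>, the quotient because at least one vertex is white.\<close>
  also have "\<dots> \<le> potential G C - 1 / 2 * (1 / 2)"
    using k by (intro diff_left_mono mult_mono) (auto simp: field_simps)
  finally show ?thesis by simp
qed

end

section \<open>From the drop in one round to the upper bound\<close>

lemma (in graph) set_pmf_pzf_round:
  assumes "D \<in> set_pmf (pzf_round G C)"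
  shows "C \<subseteq> D" "D \<subseteq> C \<union> verts G"
  using assms by (auto simp: pzf_round_def attempts_def dest: adj_in_verts)

lemma (in graph) finite_set_pzf_round: "finite (set_pmf (pzf_round G C))"
  unfolding pzf_round_def set_map_pmf
  by (simp add: set_Pi_pmf finite_attempts)
     (intro finite_imageI finite_PiE_dflt; simp add: finite_attempts)

lemma (in graph) pzf_round_verts: "pzf_round G (verts G) = return_pmf (verts G)"
proof -
  have "attempts G (verts G) = {}"
    by (auto simp: attempts_def dest: adj_in_verts)
  then show ?thesis by (simp add: pzf_round_def)
qed

text \<open>Ensures that \<open>ennreal\<close> does not truncate the potential, so that real
  expectations and nonnegative integrals agree.\<close>

lemma (in graph) potential_nonneg:
  assumes "C \<subseteq> verts G" "C \<noteq> {}"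
  shows "0 \<le> potential G C"
proof -
  have "0 < card C" "card C \<le> card (verts G)"
    using assms finite_subset[OF assms(1)] card_mono[of "verts G" C] by (auto simp: card_gt_0_iff)
  then have "0 \<le> ln (1 + real (card (verts G)) - real (card C))"
    "0 \<le> ln (real (card (verts G)) / real (card C))"
    by (simp_all add: ln_ge_zero)
  then show ?thesis unfolding potential_def by simp
qed

lemma (in graph) nn_integral_potential_drop:
  assumes univ: "universal_vertex G u" and C: "u \<in> C" "C \<subseteq> verts G"
  shows "(\<integral>\<^sup>+D. ennreal (potential G D) \<partial>pzf_round G C) +
    ennreal (1 / 10) * indicator (- {verts G}) C \<le> ennreal (potential G C)"
proof (cases "C = verts G")
  case True
  \<comment> \<open>The full blue set is absorbing and the indicator vanishes there.\<close>
  then show ?thesis by (simp add: pzf_round_verts)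
next
  case False
  interpret blue_universal G u C
    by unfold_locales (use univ C False in auto)
  have nonneg: "0 \<le> potential G D" if "D \<in> set_pmf (pzf_round G C)" for D
    using set_pmf_pzf_round[OF that] uC C by (intro potential_nonneg) auto
  have "(\<integral>\<^sup>+D. ennreal (potential G D) \<partial>pzf_round G C) = ennreal (measure_pmf.expectation (pzf_round G C) (potential G))"
    using nonneg finite_set_pzf_round
    by (intro nn_integral_eq_integral integrable_measure_pmf_finite) (auto simp: AE_measure_pmf_iff)
  moreover have "measure_pmf.expectation (pzf_round G C) (potential G) \<le> potential G C - 1 / 10"
    using expectation_potential_drop by (simp add: pzf_round_def)
  moreover have "0 \<le> measure_pmf.expectation (pzf_round G C) (potential G)"
    using nonneg by (intro integral_nonneg_AE) (auto simp: AE_measure_pmf_iff)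
  ultimately show ?thesis
    using False by (simp add: ennreal_plus[symmetric] ennreal_leI del: ennreal_plus)
qed

lemma (in graph) ept_from_universal_le:
  assumes univ: "universal_vertex G u"
  shows "ept_from G {u} \<le> ennreal (20 * ln (real (card (verts G))))"
proof -
  let ?n = "real (card (verts G))"
  have u: "u \<in> verts G" using univ by (simp add: universal_vertex_def)
  then have n: "1 \<le> ?n" using finite_verts by (auto simp: Suc_le_eq card_gt_0_iff)
  \<comment> \<open>The invariant states are the vertex sets containing \<open>u\<close>, since blue
    vertices stay blue. The initial potential is twice the logarithm of the order, whence the
    constant 20.\<close>
  have "ennreal (1 / 10) * ept_from G {u} \<le> ennreal (potential G {u})"
  proof (rule ept_from_le_potential)
    show "{u} \<in> {C. u \<in> C \<and> C \<subseteq> verts G}" using u by simp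
    fix C assume "C \<in> {C. u \<in> C \<and> C \<subseteq> verts G}"
    then have C: "u \<in> C" "C \<subseteq> verts G" by auto
    show "set_pmf (pzf_round G C) \<subseteq> {C. u \<in> C \<and> C \<subseteq> verts G}"
      using set_pmf_pzf_round[of _ C] C by blast
    show "(\<integral>\<^sup>+D. ennreal (potential G D) \<partial>pzf_round G C) + ennreal (1 / 10) * indicator (- {verts G}) C \<le> ennreal (potential G C)"
      by (rule nn_integral_potential_drop[OF univ C])
  qed
  then have "ennreal 10 * (ennreal (1 / 10) * ept_from G {u}) \<le> ennreal 10 * ennreal (potential G {u})"
    by (intro mult_left_mono) auto
  also have "ennreal 10 * (ennreal (1 / 10) * ept_from G {u}) = ept_from G {u}"
    by (simp add: mult.assoc[symmetric] ennreal_mult[symmetric] del: ennreal_numeral)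
  also have "ennreal 10 * ennreal (potential G {u}) = ennreal (20 * ln ?n)"
    using n by (subst ennreal_mult[symmetric]) (auto simp: potential_def)
  finally show ?thesis .
qed

section \<open>Logarithmic bounds\<close>

lemma nn_integral_card_blue_pmf_le:
  assumes "graph G" "pre_digraph.del_vert G u \<in> bounded_degree_graphs c" "B \<subseteq> verts G"
  shows "(\<integral>\<^sup>+D. of_nat (card D) \<partial>blue_pmf G B t) \<le> of_nat ((c + 4) ^ t * card B)"
proof -
  interpret graph G by fact
  have sub: "set_pmf (blue_pmf G B t) \<subseteq> Pow (verts G)" for t
  proof (induction t)
    case (Suc t)
    then show ?case using set_pmf_pzf_round(2) by fastforce
  qed (use assms(3) in simp)
  show ?thesis
  proof (induction t)
    case (Suc t)
    have "(\<integral>\<^sup>+D. of_nat (card D) \<partial>blue_pmf G B (Suc t)) =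
        (\<integral>\<^sup>+C. (\<integral>\<^sup>+D. of_nat (card D) \<partial>pzf_round G C) \<partial>blue_pmf G B t)"
      by (simp add: nn_integral_bind_pmf)
    also have "\<dots> \<le> (\<integral>\<^sup>+C. of_nat (c + 4) * of_nat (card C) \<partial>blue_pmf G B t)"
      using sub[of t] nn_integral_card_pzf_round_le[OF assms(1,2)]
      by (intro nn_integral_mono_AE) (auto simp: AE_measure_pmf_iff)
    also have "\<dots> = of_nat (c + 4) * (\<integral>\<^sup>+C. of_nat (card C) \<partial>blue_pmf G B t)"
      by (rule nn_integral_cmult) simp
    also have "\<dots> \<le> of_nat (c + 4) * of_nat ((c + 4) ^ t * card B)"
      by (intro mult_left_mono Suc.IH) simp
    also have "\<dots> = of_nat ((c + 4) ^ Suc t * card B)"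
      by (simp only: of_nat_mult[symmetric] power_Suc mult.assoc)
    finally show ?case .
  qed simp
qed

lemma ept_from_singleton_ge:
  assumes "graph G" "pre_digraph.del_vert G u \<in> bounded_degree_graphs c" "v \<in> verts G"
    and m: "2 * (c + 4) ^ m \<le> card (verts G)"
  shows "ennreal (real m / 2) \<le> ept_from G {v}"
proof -
  interpret graph G by fact
  let ?n = "card (verts G)" and ?P = "\<lambda>t. measure_pmf.prob (blue_pmf G {v} t) {verts G}"
  have P: "real ?n * ?P t \<le> real ((c + 4) ^ t)" for t
  proof -
    have "of_nat ?n * emeasure (blue_pmf G {v} t) {verts G} =
        (\<integral>\<^sup>+D. of_nat ?n * indicator {verts G} D \<partial>blue_pmf G {v} t)"
      by (simp add: nn_integral_cmult)
    \<comment> \<open>Markov's inequality: on the full blue set the cardinality equals the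
      order.\<close>
    also have "\<dots> \<le> (\<integral>\<^sup>+D. of_nat (card D) \<partial>blue_pmf G {v} t)"
      by (intro nn_integral_mono) (auto split: split_indicator)
    also have "\<dots> \<le> of_nat ((c + 4) ^ t)"
      using nn_integral_card_blue_pmf_le[OF assms(1,2), of "{v}" t] assms(3) by simp
    finally have "ennreal (real ?n * ?P t) \<le> ennreal (real ((c + 4) ^ t))"
      by (simp only: measure_pmf.emeasure_eq_measure ennreal_of_nat_eq_real_of_nat ennreal_mult'' measure_nonneg of_nat_0_le_iff)
    then show ?thesis by (subst (asm) ennreal_le_iff) auto
  qed
  \<comment> \<open>The ratio is at least 2, so each power dominates the sum of all lower
    ones.\<close>
  have geo: "(\<Sum>t<m. (c + 4) ^ t) \<le> (c + 4) ^ m" for m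
    by (induction m) (simp_all add: algebra_simps)
  have "real ?n * (\<Sum>t<m. ?P t) \<le> (\<Sum>t<m. real ((c + 4) ^ t))"
    unfolding sum_distrib_left by (intro sum_mono P)
  also have "\<dots> \<le> real ((c + 4) ^ m)"
    using geo[of m] by (simp only: of_nat_mono flip: of_nat_sum)
  also have "\<dots> \<le> real ?n * (1 / 2)"
    using of_nat_mono[OF m, where 'a = real] by simp
  finally have sum: "(\<Sum>t<m. ?P t) \<le> 1 / 2"
    using m by (subst (asm) mult_le_cancel_left_pos) (auto intro: Nat.gr0I)
  have "ennreal (real m / 2) = of_nat m * ennreal (1 / 2)"
    by (simp only: ennreal_of_nat_eq_real_of_nat flip: ennreal_mult'') simp
  also have "\<dots> \<le> of_nat m * ennreal (1 - (\<Sum>t<m. ?P t))"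
    using sum by (intro mult_left_mono ennreal_leI) auto
  also have "ennreal (1 - (\<Sum>t<m. ?P t)) = 1 - (\<Sum>t<m. emeasure (blue_pmf G {v} t) {verts G})"
    by (simp add: measure_pmf.emeasure_eq_measure sum_nonneg ennreal_minus[symmetric] del: ennreal_minus)
  also have "of_nat m * \<dots> \<le> ept_from G {v}"
    by (rule ept_from_ge)
  finally show ?thesis .
qed

theorem theorem3p2:
  fixes c :: nat
  assumes "c > 0"
  shows "\<exists>c1 c2 :: real. \<exists>n0 :: nat. c1 > 0 \<and> c2 > 0 \<and>
    (\<forall>(G :: ('a, 'b) pre_digraph) u n.
       graph G \<and> card (verts G) = n \<and> n \<ge> n0 \<and>
       universal_vertex G u \<and> pre_digraph.del_vert G u \<in> bounded_degree_graphs c \<longrightarrow>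
       ennreal (c1 * ln (real n)) \<le> ept G \<and> ept G \<le> ennreal (c2 * ln (real n)))"
proof -
  define L where "L = ln (real (c + 4))"
  have L: "0 < L" unfolding L_def by simp
  show ?thesis
  proof (intro exI conjI allI impI)
    \<comment> \<open>With \<open>m\<close> the floor of \<open>ln n / (2 * L)\<close>, rounding
      down loses at most half once \<open>ln n \<ge> 4 * L\<close>; hence the threshold
      \<open>(c + 4) ^ 4\<close>. Then \<open>m \<ge> ln n / (4 * L)\<close>, and the bound
      \<open>m / 2\<close> yields \<open>1 / (8 * L)\<close>.\<close>
    show "0 < 1 / (8 * L)" "(0::real) < 20" using L by simp_all
    fix G :: "('a, 'b) pre_digraph" and u n
    assume "graph G \<and> card (verts G) = n \<and> (c + 4) ^ 4 \<le> n \<and>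
       universal_vertex G u \<and> pre_digraph.del_vert G u \<in> bounded_degree_graphs c"
    then have G: "graph G" and n: "card (verts G) = n" and n0: "(c + 4) ^ 4 \<le> n"
      and univ: "universal_vertex G u" and del: "pre_digraph.del_vert G u \<in> bounded_degree_graphs c"
      by auto
    interpret graph G by (rule G)
    have u: "u \<in> verts G" using univ by (simp add: universal_vertex_def)
    have "ept G \<le> ept_from G {u}"
      unfolding ept_def using u by (intro Min_le) auto
    then show "ept G \<le> ennreal (20 * ln (real n))"
      using ept_from_universal_le[OF univ] n by simp
    have npos: "0 < real n" using n0 by (auto intro: Nat.gr0I)
    have "real ((c + 4) ^ 4) \<le> real n" using n0 by (simp only: of_nat_mono)
    then have "ln (real ((c + 4) ^ 4)) \<le> ln (real n)"
      using npos by (subst ln_le_cancel_iff) auto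
    then have ln4: "4 * L \<le> ln (real n)"
      by (simp add: L_def ln_realpow)
    \<comment> \<open>About half the logarithm of \<open>n\<close> to base \<open>c + 4\<close>: the
      power is then near the square root of \<open>n\<close>, leaving room for the factor 2.\<close>
    define m where "m = nat \<lfloor>ln (real n) / (2 * L)\<rfloor>"
    have q: "2 \<le> ln (real n) / (2 * L)"
      using ln4 L by (simp add: field_simps)
    then have m: "real m \<le> ln (real n) / (2 * L)" "ln (real n) / (2 * L) - 1 \<le> real m"
      unfolding m_def by linarith+
    have "ln (2 * real (c + 4) ^ m) = ln 2 + real m * L"
      by (simp add: L_def ln_mult_pos ln_realpow)
    also have "\<dots> \<le> L + ln (real n) / 2"
    proof -
      have "ln 2 \<le> L" unfolding L_def by simp
      moreover have "real m * L \<le> ln (real n) / (2 * L) * L"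
        using m(1) L by (intro mult_right_mono) auto
      ultimately show ?thesis using L by simp
    qed
    also have "\<dots> \<le> ln (real n)" using ln4 L by simp
    finally have "2 * real (c + 4) ^ m \<le> real n"
      using npos by (subst (asm) ln_le_cancel_iff) auto
    then have "real (2 * (c + 4) ^ m) \<le> real n" by simp
    then have pow: "2 * (c + 4) ^ m \<le> card (verts G)"
      unfolding n by (simp only: of_nat_le_iff)
    have "1 / (8 * L) * ln (real n) \<le> real m / 2"
    proof -
      have "1 / (8 * L) * ln (real n) = (ln (real n) / (2 * L)) / 4" by simp
      also have "\<dots> \<le> real m / 2"
        using q m(2) by argo
      finally show ?thesis .
    qed
    \<comment> \<open>As \<open>ept\<close> is a minimum, the lower bound has to cover every
      starting vertex, whereas \<open>u\<close> alone gave the upper one.\<close>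
    then have "ennreal (1 / (8 * L) * ln (real n)) \<le> ept_from G {v}" if "v \<in> verts G" for v
      using ept_from_singleton_ge[OF G del that pow] by (meson ennreal_leI order_trans)
    then show "ennreal (1 / (8 * L) * ln (real n)) \<le> ept G"
      unfolding ept_def using u by (subst Min_ge_iff) auto
  qed
qed

end
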